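(* Let $X$ be an operator space with a cb-frame $(x_i,f_i)$, $\|x_i\|=1$ for all $i$, and let $Y$ be the associated operator space with canonical basis $(e_i)$ and matrix norms $|\|\cdot|\|_n$ as defined in the context. Suppose $Z$ is an operator space with a cb-basis $(z_i)$ such that the maps $$Q_Z:\sum a_iz_i\in Z\mapsto\sum a_ix_i\in X,\qquad T_Z:x=\sum f_i(x)x_i\in X\mapsto\sum f_i(x)z_i\in Z$$ are (well defined and) completely bounded. Let $K_Z=\sup_m\|P_m^Z\|_{cb}$, where $P^Z_m$ are the natural projections of the basis $(z_i)$, and let $K=\|Q_Z\|_{cb}K_Z$. Then for every $n\in\mathbb{N}$ and every family $(u_i)\subset\mathbb{M}_n$ with finitely many nonzero terms, $$|\|\sum u_i\otimes e_i|\|_n\le K\,\|\sum u_i\otimes z_i\|_n .$$ That is, the basis $(e_i)$ of $Y$ is completely dominated by every such cb-basis $(z_i)$.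
   Context: Operator spaces are norm-complete, $\mathbb{M}_n$ denotes the $n\times n$ complex matrices, $\|\cdot\|_n$ is the matrix norm on $\mathbb{M}_n(V)=\mathbb{M}_n\otimes V$ for an operator space $V$, and $\|\cdot\|_{cb}$ is the completely bounded norm. A cb-frame for an operator space $X$ is a sequence $(x_i,f_i)_{i\in\mathbb{N}}\subset X\times X^*$ with $x=\sum_{i=1}^\infty f_i(x)x_i$ (norm convergent) for all $x\in X$ and $\sup_m\|S_m\|_{cb}<\infty$, where $S_m(x)=\sum_{i=1}^mf_i(x)x_i$. A cb-basis of an operator space $Z$ is a Schauder basis $(z_i)$ whose natural projections $P^Z_m(\sum_{i=1}^\infty\alpha_iz_i)=\sum_{i=1}^m\alpha_iz_i$ satisfy $\sup_m\|P^Z_m\|_{cb}<\infty$. Given a cb-frame $(x_i,f_i)$ of $X$ with $\|x_i\|=1$ for all $i$, let $c_{00}$ be the space of finitely supported complex sequences with canonical basis $(e_i)$, and for $u=\sum u_i\otimes e_i\in\mathbb{M}_n(c_{00})$ ($u_i\in\mathbb{M}_n$, finitely many nonzero) put $$|\|u|\|_n=\max_{m\ge1}\Big\|\sum_{i=1}^mu_i\otimes x_i\Big\|_n .$$ These norms make $c_{00}$ a (non-complete) operator space, and $Y$ is its completion. *)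

theory Defs
  imports "HOL-Analysis.Analysis" "Jordan_Normal_Form.Matrix"
begin

class scaleC =
  fixes scaleC :: "complex \<Rightarrow> 'a \<Rightarrow> 'a"  (infixr "*\<^sub>C" 75)

class complex_banach = banach + scaleC +
  assumes scaleC_add_right: "c *\<^sub>C (x + y) = c *\<^sub>C x + c *\<^sub>C y"
    and scaleC_add_left: "(c + d) *\<^sub>C x = c *\<^sub>C x + d *\<^sub>C x"
    and scaleC_scaleC: "c *\<^sub>C (d *\<^sub>C x) = (c * d) *\<^sub>C x"
    and scaleC_one: "1 *\<^sub>C x = x"
    and scaleR_scaleC: "r *\<^sub>R x = complex_of_real r *\<^sub>C x"
    and norm_scaleC: "norm (c *\<^sub>C x) = cmod c * norm x"

lemma vector_space_scaleC: "vector_space (scaleC :: complex \<Rightarrow> 'a::complex_banach \<Rightarrow> 'a)"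
  by unfold_locales (simp_all add: scaleC_add_right scaleC_add_left scaleC_scaleC scaleC_one)

definition l2_vec_norm :: "complex vec \<Rightarrow> real" where
  "l2_vec_norm v = sqrt (\<Sum>i<dim_vec v. (cmod (v $ i))\<^sup>2)"

definition mat_op_norm :: "complex mat \<Rightarrow> real" where
  "mat_op_norm A = Sup {l2_vec_norm (A *\<^sub>v v) | v. v \<in> carrier_vec (dim_col A) \<and> l2_vec_norm v \<le> 1}"

text \<open>The matrix \<open>\<alpha> u \<beta>\<close> for scalar matrices \<open>\<alpha>\<close>, \<open>\<beta>\<close> and a matrix \<open>u\<close> over \<open>V\<close>.\<close>

definition (in complex_banach) mat_bimod :: "complex mat \<Rightarrow> 'a mat \<Rightarrow> complex mat \<Rightarrow> 'a mat" where
  "mat_bimod \<alpha> u \<beta> = mat (dim_row \<alpha>) (dim_col \<beta>)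
     (\<lambda>(i, j). \<Sum>k<dim_row u. \<Sum>l<dim_col u. (\<alpha> $$ (i, k) * \<beta> $$ (l, j)) *\<^sub>C (u $$ (k, l)))"

text \<open>
  The following three are the zero matrix, the sum and the diagonal sum of matrices, spelled out
  because the library operations are not available inside a class specification.
\<close>

definition (in complex_banach) mat_zero :: "nat \<Rightarrow> 'a mat" where
  "mat_zero n = mat n n (\<lambda>_. 0)"

definition (in complex_banach) mat_plus :: "'a mat \<Rightarrow> 'a mat \<Rightarrow> 'a mat" where
  "mat_plus u v = mat (dim_row v) (dim_col v) (\<lambda>ij. u $$ ij + v $$ ij)"

definition (in complex_banach) mat_dsum :: "'a mat \<Rightarrow> 'a mat \<Rightarrow> 'a mat" where
  "mat_dsum u v = mat (dim_row u + dim_row v) (dim_col u + dim_col v)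
     (\<lambda>(i, j). if i < dim_row u
                 then if j < dim_col u then u $$ (i, j) else 0
                 else if j < dim_col u then 0 else v $$ (i - dim_row u, j - dim_col u))"

lemma mat_zero_eq: "mat_zero n = 0\<^sub>m n n"
  by (simp add: mat_zero_def zero_mat_def)

lemma mat_plus_eq: "mat_plus u v = u + v"
  by (simp add: mat_plus_def plus_mat_def)

lemma mat_dsum_eq:
  "mat_dsum u v = four_block_mat u (0\<^sub>m (dim_row u) (dim_col v)) (0\<^sub>m (dim_row v) (dim_col u)) v"
  by (rule eq_matI) (auto simp: mat_dsum_def)

text \<open>
  Complete operator spaces, axiomatised by Ruan's conditions. \<open>\<M>\<^sub>n(V)\<close> is
  \<open>carrier_mat n n\<close> over \<open>V\<close> with \<open>n \<ge> 1\<close>; as a matrix carries its own dimension,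
  the single function \<open>mnorm\<close> stands for the whole sequence of matrix norms.
  Completeness of \<open>V\<close> (class \<^class>\<open>banach\<close>) entails completeness of all \<open>\<M>\<^sub>n(V)\<close>.
\<close>

class operator_space = complex_banach +
  fixes mnorm :: "'a mat \<Rightarrow> real"
  assumes mnorm_eq_0: "n \<ge> 1 \<Longrightarrow> u \<in> carrier_mat n n \<Longrightarrow> mnorm u = 0 \<longleftrightarrow> u = mat_zero n"
    and mnorm_triangle: "n \<ge> 1 \<Longrightarrow> u \<in> carrier_mat n n \<Longrightarrow> v \<in> carrier_mat n n \<Longrightarrow>
           mnorm (mat_plus u v) \<le> mnorm u + mnorm v"
    and mnorm_scaleC: "n \<ge> 1 \<Longrightarrow> u \<in> carrier_mat n n \<Longrightarrow>
           mnorm (map_mat (scaleC c) u) = cmod c * mnorm u"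
    and mnorm_1: "mnorm (mat 1 1 (\<lambda>_. x)) = norm x"
    and mnorm_dsum: "m \<ge> 1 \<Longrightarrow> n \<ge> 1 \<Longrightarrow> u \<in> carrier_mat m m \<Longrightarrow> v \<in> carrier_mat n n \<Longrightarrow>
           mnorm (mat_dsum u v) = max (mnorm u) (mnorm v)"
    and mnorm_bimod: "m \<ge> 1 \<Longrightarrow> n \<ge> 1 \<Longrightarrow> \<alpha> \<in> carrier_mat m n \<Longrightarrow> u \<in> carrier_mat n n \<Longrightarrow>
           \<beta> \<in> carrier_mat n m \<Longrightarrow>
           mnorm (mat_bimod \<alpha> u \<beta>) \<le> mat_op_norm \<alpha> * mnorm u * mat_op_norm \<beta>"

definition completely_bounded :: "('a::operator_space \<Rightarrow> 'b::operator_space) \<Rightarrow> bool" where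
  "completely_bounded T \<longleftrightarrow> Vector_Spaces.linear scaleC scaleC T \<and>
     (\<exists>C. \<forall>n\<ge>1. \<forall>u \<in> carrier_mat n n. mnorm (map_mat T u) \<le> C * mnorm u)"

definition amp_norm :: "nat \<Rightarrow> ('a::operator_space \<Rightarrow> 'b::operator_space) \<Rightarrow> real" where
  "amp_norm n T = (SUP u \<in> {u \<in> carrier_mat n n. mnorm u \<le> 1}. mnorm (map_mat T u))"

text \<open>Meaningful for completely bounded maps only: both suprema are taken in the reals.\<close>

definition cb_norm :: "('a::operator_space \<Rightarrow> 'b::operator_space) \<Rightarrow> real" where
  "cb_norm T = (SUP n \<in> {1..}. amp_norm n T)"

text \<open>
  Sequences are indexed from \<open>0\<close>, so the \<open>m\<close>-th partial sum operators below sum over \<open>i \<le> m\<close>.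
\<close>

definition cdual :: "('a::operator_space \<Rightarrow> complex) set" where
  "cdual = {\<phi>. Vector_Spaces.linear scaleC (*) \<phi> \<and> bounded_linear \<phi>}"

definition frame_partial ::
    "(nat \<Rightarrow> 'a::operator_space) \<Rightarrow> (nat \<Rightarrow> 'a \<Rightarrow> complex) \<Rightarrow> nat \<Rightarrow> 'a \<Rightarrow> 'a" where
  "frame_partial x f m v = (\<Sum>i\<le>m. f i v *\<^sub>C x i)"

definition cb_frame :: "(nat \<Rightarrow> 'a::operator_space) \<Rightarrow> (nat \<Rightarrow> 'a \<Rightarrow> complex) \<Rightarrow> bool" where
  "cb_frame x f \<longleftrightarrow> (\<forall>i. f i \<in> cdual) \<and> (\<forall>v. (\<lambda>i. f i v *\<^sub>C x i) sums v) \<and>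
     (\<forall>m. completely_bounded (frame_partial x f m)) \<and>
     bdd_above (range (\<lambda>m. cb_norm (frame_partial x f m)))"

definition schauder_basis :: "(nat \<Rightarrow> 'a::operator_space) \<Rightarrow> bool" where
  "schauder_basis z \<longleftrightarrow> (\<forall>v. \<exists>!a :: nat \<Rightarrow> complex. (\<lambda>i. a i *\<^sub>C z i) sums v)"

definition basis_coeff :: "(nat \<Rightarrow> 'a::operator_space) \<Rightarrow> 'a \<Rightarrow> nat \<Rightarrow> complex" where
  "basis_coeff z v = (THE a. (\<lambda>i. a i *\<^sub>C z i) sums v)"

definition basis_proj :: "(nat \<Rightarrow> 'a::operator_space) \<Rightarrow> nat \<Rightarrow> 'a \<Rightarrow> 'a" where
  "basis_proj z m v = (\<Sum>i\<le>m. basis_coeff z v i *\<^sub>C z i)"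

definition cb_basis :: "(nat \<Rightarrow> 'a::operator_space) \<Rightarrow> bool" where
  "cb_basis z \<longleftrightarrow> schauder_basis z \<and> (\<forall>m. completely_bounded (basis_proj z m)) \<and>
     bdd_above (range (\<lambda>m. cb_norm (basis_proj z m)))"

definition basis_const :: "(nat \<Rightarrow> 'a::operator_space) \<Rightarrow> real" where
  "basis_const z = (SUP m. cb_norm (basis_proj z m))"

definition Q_map :: "(nat \<Rightarrow> 'z::operator_space) \<Rightarrow> (nat \<Rightarrow> 'x::operator_space) \<Rightarrow> 'z \<Rightarrow> 'x" where
  "Q_map z x v = (\<Sum>i. basis_coeff z v i *\<^sub>C x i)"

definition T_map ::
    "(nat \<Rightarrow> 'x::operator_space \<Rightarrow> complex) \<Rightarrow> (nat \<Rightarrow> 'z::operator_space) \<Rightarrow> 'x \<Rightarrow> 'z" where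
  "T_map f z v = (\<Sum>i. f i v *\<^sub>C z i)"

text \<open>
  An element \<open>\<Sum> u\<^sub>i \<otimes> e\<^sub>i\<close> of \<open>\<M>\<^sub>n(c\<^sub>0\<^sub>0)\<close> is represented by its coefficient family \<open>u\<close>.
\<close>

definition fin_families :: "nat \<Rightarrow> (nat \<Rightarrow> complex mat) set" where
  "fin_families n = {u. (\<forall>i. u i \<in> carrier_mat n n) \<and> finite {i. u i \<noteq> 0\<^sub>m n n}}"

text \<open>\<open>tensor_sum n I u x\<close> is \<open>\<Sum>i\<in>I. u\<^sub>i \<otimes> x\<^sub>i\<close> in \<open>\<M>\<^sub>n(V)\<close>.\<close>

definition tensor_sum ::
    "nat \<Rightarrow> nat set \<Rightarrow> (nat \<Rightarrow> complex mat) \<Rightarrow> (nat \<Rightarrow> 'a::operator_space) \<Rightarrow> 'a mat" where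
  "tensor_sum n I u x = mat n n (\<lambda>(k, l). \<Sum>i\<in>I. (u i $$ (k, l)) *\<^sub>C x i)"

definition full_tensor_sum ::
    "nat \<Rightarrow> (nat \<Rightarrow> complex mat) \<Rightarrow> (nat \<Rightarrow> 'a::operator_space) \<Rightarrow> 'a mat" where
  "full_tensor_sum n u x = tensor_sum n {i. u i \<noteq> 0\<^sub>m n n} u x"

text \<open>The maximum exists: the partial sums of a family in \<open>fin_families n\<close> are eventually constant.\<close>

definition triple_norm ::
    "(nat \<Rightarrow> 'a::operator_space) \<Rightarrow> nat \<Rightarrow> (nat \<Rightarrow> complex mat) \<Rightarrow> real" where
  "triple_norm x n u = Max (range (\<lambda>m. mnorm (tensor_sum n {..m} u x)))"

text \<open>
  The operator space \<open>Y\<close>, given by a type together with the images \<open>e\<^sub>i\<close> of the canonical basis of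
  \<open>c\<^sub>0\<^sub>0\<close>, is a completion of \<open>c\<^sub>0\<^sub>0\<close> with the norms \<open>triple_norm x\<close>: the linear embedding of
  \<open>c\<^sub>0\<^sub>0\<close> into \<open>Y\<close> is completely isometric with dense range.
\<close>

definition c00_completion ::
    "(nat \<Rightarrow> 'x::operator_space) \<Rightarrow> (nat \<Rightarrow> 'y::operator_space) \<Rightarrow> bool" where
  "c00_completion x e \<longleftrightarrow>
     (\<forall>n\<ge>1. \<forall>u \<in> fin_families n. mnorm (full_tensor_sum n u e) = triple_norm x n u) \<and>
     closure (module.span scaleC (range e)) = UNIV"

end

theory Submission
  imports Defs
begin

text \<open>
  The partial sum \<open>\<Sum>i\<le>m. u\<^sub>i \<otimes> x\<^sub>i\<close> is the image of \<open>\<Sum>i. u\<^sub>i \<otimes> z\<^sub>i\<close> under the amplification of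
  \<open>Q\<^sub>Z \<circ> P\<^sub>m\<^sup>Z\<close>, so its norm is at most \<open>\<parallel>Q\<^sub>Z\<parallel>\<^sub>c\<^sub>b \<parallel>P\<^sub>m\<^sup>Z\<parallel>\<^sub>c\<^sub>b\<close> times that of \<open>\<Sum>i. u\<^sub>i \<otimes> z\<^sub>i\<close>.
\<close>

lemma scaleC_zero_left [simp]: "0 *\<^sub>C (v :: 'a::complex_banach) = 0"
  using scaleC_add_left[of 0 0 v] by simp

lemma mnorm_zero:
  assumes "n \<ge> 1"
  shows "mnorm (0\<^sub>m n n :: 'a::operator_space mat) = 0"
  using mnorm_eq_0[OF assms, of "0\<^sub>m n n :: 'a mat"] by (simp add: mat_zero_eq)

text \<open>Positivity is not among Ruan's axioms as stated; it follows from the triangle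
  inequality, since \<open>0 = mnorm (u + (-1) u) \<le> 2 * mnorm u\<close>.\<close>

lemma mnorm_nonneg:
  fixes u :: "'a::operator_space mat"
  assumes n: "n \<ge> 1" and u: "u \<in> carrier_mat n n"
  shows "mnorm u \<ge> 0"
proof -
  let ?v = "map_mat (scaleC (-1)) u"
  have v: "?v \<in> carrier_mat n n"
    using u by simp
  have neg: "w + (-1) *\<^sub>C w = 0" for w :: 'a
    using scaleC_add_left[of 1 "-1" w] by (simp add: scaleC_one)
  have "u + ?v = 0\<^sub>m n n"
    using u by (intro eq_matI) (auto simp: neg)
  then have "mnorm (0\<^sub>m n n :: 'a mat) \<le> mnorm u + mnorm ?v"
    using mnorm_triangle[OF n u v] by (simp add: mat_plus_eq)
  then show ?thesis
    by (simp add: mnorm_zero[OF n] mnorm_scaleC[OF n u])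
qed

lemma completely_bounded_map_zero:
  assumes "completely_bounded T"
  shows "map_mat T (0\<^sub>m n n) = 0\<^sub>m n n"
proof -
  interpret Vector_Spaces.linear scaleC scaleC T
    using assms by (simp add: completely_bounded_def)
  show ?thesis
    by (intro eq_matI) (auto simp: zero)
qed

text \<open>A real supremum dominates its members only if they are bounded above. The constant from
  complete boundedness bounds both nested suprema, over the unit ball and over the matrix
  size.\<close>

lemma mnorm_map_le_cb_norm_unit:
  fixes T :: "'a::operator_space \<Rightarrow> 'b::operator_space"
  assumes T: "completely_bounded T" and n: "n \<ge> 1" and u: "u \<in> carrier_mat n n"
    and le1: "mnorm u \<le> 1"
  shows "mnorm (map_mat T u) \<le> cb_norm T"
proof -
  obtain C where C: "\<And>k v. k \<ge> 1 \<Longrightarrow> v \<in> carrier_mat k k \<Longrightarrow> mnorm (map_mat T v) \<le> C * mnorm v"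
    using T unfolding completely_bounded_def by blast
  \<comment> \<open>\<open>C\<close> carries no sign, so its absolute value is needed to replace
    \<open>mnorm v\<close> by 1.\<close>
  have bound: "mnorm (map_mat T v) \<le> \<bar>C\<bar>"
    if "k \<ge> 1" "v \<in> carrier_mat k k" "mnorm v \<le> 1" for k v
  proof -
    have "mnorm (map_mat T v) \<le> C * mnorm v"
      using C that by blast
    also have "\<dots> \<le> \<bar>C\<bar> * 1"
      using that mnorm_nonneg[of k v] by (intro mult_mono) auto
    finally show ?thesis by simp
  qed
  have amp_le: "amp_norm k T \<le> \<bar>C\<bar>" if "k \<ge> 1" for k
    unfolding amp_norm_def
  proof (rule cSUP_least)
    have "(0\<^sub>m k k :: 'a mat) \<in> {u \<in> carrier_mat k k. mnorm u \<le> 1}"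
      using mnorm_zero[OF that, where 'a='a] by simp
    then show "{u \<in> carrier_mat k k. mnorm (u :: 'a mat) \<le> 1} \<noteq> {}"
      by blast
  qed (use bound that in auto)
  have "mnorm (map_mat T u) \<le> amp_norm n T"
    unfolding amp_norm_def using n u le1 bound
    by (intro cSUP_upper bdd_aboveI2[where M = "\<bar>C\<bar>"]) auto
  also have "\<dots> \<le> cb_norm T"
    unfolding cb_norm_def using n amp_le
    by (intro cSUP_upper bdd_aboveI2[where M = "\<bar>C\<bar>"]) auto
  finally show ?thesis .
qed

lemma cb_norm_nonneg:
  fixes T :: "'a::operator_space \<Rightarrow> 'b::operator_space"
  assumes T: "completely_bounded T"
  shows "cb_norm T \<ge> 0"
  using mnorm_map_le_cb_norm_unit[OF T, of 1 "0\<^sub>m 1 1"]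
  by (simp add: completely_bounded_map_zero[OF T] mnorm_zero)

text \<open>Homogeneity reduces this to the unit ball: a nonzero \<open>u\<close> is scaled to norm
  1, and for \<open>mnorm u = 0\<close> both sides vanish.\<close>

lemma mnorm_map_le_cb_norm:
  fixes T :: "'a::operator_space \<Rightarrow> 'b::operator_space"
  assumes T: "completely_bounded T" and n: "n \<ge> 1" and u: "u \<in> carrier_mat n n"
  shows "mnorm (map_mat T u) \<le> cb_norm T * mnorm u"
proof (cases "mnorm u = 0")
  case True
  then have "u = 0\<^sub>m n n"
    using mnorm_eq_0[OF n u] by (simp add: mat_zero_eq)
  then show ?thesis
    using True completely_bounded_map_zero[OF T, of n] mnorm_zero[OF n, where 'a='b] by simp
next
  case False
  then have pos: "mnorm u > 0"
    using mnorm_nonneg[OF n u] by simp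
  interpret Vector_Spaces.linear scaleC scaleC T
    using T by (simp add: completely_bounded_def)
  let ?c = "complex_of_real (inverse (mnorm u))"
  have cmod_c: "cmod ?c = inverse (mnorm u)"
    using pos by (simp only: norm_of_real) simp
  have "mnorm (map_mat (scaleC ?c) u) = 1"
    using pos by (simp only: mnorm_scaleC[OF n u] cmod_c) simp
  then have "mnorm (map_mat T (map_mat (scaleC ?c) u)) \<le> cb_norm T"
    using u by (intro mnorm_map_le_cb_norm_unit[OF T n]) auto
  also have "map_mat T (map_mat (scaleC ?c) u) = map_mat (scaleC ?c) (map_mat T u)"
    using u by (intro eq_matI) (auto simp: scale)
  also have "mnorm \<dots> = inverse (mnorm u) * mnorm (map_mat T u)"
    using mnorm_scaleC[OF n, of "map_mat T u" ?c] u by (simp only: cmod_c) simp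
  finally show ?thesis
    using pos by (simp add: field_simps)
qed

text \<open>Extending \<open>a\<close> by zero outside \<open>I\<close> gives an expansion of the
  vector, and Schauder expansions are unique.\<close>

lemma basis_coeff_finite_sum:
  fixes z :: "nat \<Rightarrow> 'z::operator_space"
  assumes z: "schauder_basis z" and I: "finite I"
  shows "basis_coeff z (\<Sum>i\<in>I. a i *\<^sub>C z i) = (\<lambda>i. if i \<in> I then a i else 0)"
proof -
  let ?b = "\<lambda>i. if i \<in> I then a i else 0"
  have "(\<lambda>i. ?b i *\<^sub>C z i) sums (\<Sum>i\<in>I. ?b i *\<^sub>C z i)"
    using I by (intro sums_finite) auto
  then have "(\<lambda>i. ?b i *\<^sub>C z i) sums (\<Sum>i\<in>I. a i *\<^sub>C z i)"
    by simp
  then show ?thesis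
    unfolding basis_coeff_def using z unfolding schauder_basis_def
    by (intro the1_equality) blast+
qed

lemma basis_proj_finite_sum:
  fixes z :: "nat \<Rightarrow> 'z::operator_space"
  assumes "schauder_basis z" and "finite I"
  shows "basis_proj z m (\<Sum>i\<in>I. a i *\<^sub>C z i) = (\<Sum>i\<in>I \<inter> {..m}. a i *\<^sub>C z i)"
  unfolding basis_proj_def basis_coeff_finite_sum[OF assms]
  by (intro sum.mono_neutral_cong_right) auto

text \<open>The coefficients vanish outside \<open>I\<close>, so the series defining
  \<open>Q_map\<close> collapses to a finite sum.\<close>

lemma Q_map_finite_sum:
  fixes z :: "nat \<Rightarrow> 'z::operator_space" and x :: "nat \<Rightarrow> 'x::operator_space"
  assumes "schauder_basis z" and "finite I"
  shows "Q_map z x (\<Sum>i\<in>I. a i *\<^sub>C z i) = (\<Sum>i\<in>I. a i *\<^sub>C x i)"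
  unfolding Q_map_def basis_coeff_finite_sum[OF assms]
  using assms(2) by (subst suminf_finite[of I]) auto

lemma tensor_sum_carrier [simp]: "tensor_sum n I u x \<in> carrier_mat n n"
  by (simp add: tensor_sum_def)

lemma tensor_sum_restrict_support:
  assumes "finite I"
  shows "tensor_sum n I u x = tensor_sum n ({i. u i \<noteq> 0\<^sub>m n n} \<inter> I) u x"
  unfolding tensor_sum_def using assms
  by (intro eq_matI) (auto intro!: sum.mono_neutral_right)

text \<open>\<open>Max\<close> is meaningful only on a finite set. Each partial sum depends only on
  which part of the finite support it meets, so finitely many norms occur.\<close>

lemma triple_norm_le:
  fixes x :: "nat \<Rightarrow> 'x::operator_space"
  assumes u: "u \<in> fin_families n"
    and le: "\<And>m. mnorm (tensor_sum n {..m} u x) \<le> B"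
  shows "triple_norm x n u \<le> B"
proof -
  let ?S = "{i. u i \<noteq> 0\<^sub>m n n}"
  have "range (\<lambda>m. mnorm (tensor_sum n {..m} u x)) \<subseteq> (\<lambda>J. mnorm (tensor_sum n J u x)) ` Pow ?S"
    using tensor_sum_restrict_support[of "{.._}" n u x] by (auto intro!: image_eqI)
  moreover have "finite ?S"
    using u by (simp add: fin_families_def)
  ultimately have "finite (range (\<lambda>m. mnorm (tensor_sum n {..m} u x)))"
    by (meson finite_Pow_iff finite_imageI finite_subset)
  then show ?thesis
    unfolding triple_norm_def using le by (subst Max_le_iff) auto
qed

text \<open>Amplifications act entrywise, and every entry is a finite combination of the
  \<open>z i\<close>: the projection discards the indices above \<open>m\<close>, and
  \<open>Q_map\<close> turns \<open>z i\<close> into \<open>x i\<close>.\<close>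

lemma Q_map_basis_proj_tensor_sum:
  fixes z :: "nat \<Rightarrow> 'z::operator_space" and x :: "nat \<Rightarrow> 'x::operator_space"
  assumes z: "schauder_basis z" and u: "u \<in> fin_families n"
  shows "map_mat (Q_map z x) (map_mat (basis_proj z m) (full_tensor_sum n u z))
       = tensor_sum n {..m} u x"
proof -
  have fin: "finite {i. u i \<noteq> 0\<^sub>m n n}"
    using u by (simp add: fin_families_def)
  show ?thesis
    \<comment> \<open>This gives the right-hand side the index set that the projection leaves: the
      support cut at \<open>m\<close>.\<close>
    unfolding tensor_sum_restrict_support[OF finite_atMost]
    unfolding full_tensor_sum_def tensor_sum_def using fin by (intro eq_matI)
      (auto simp: basis_proj_finite_sum[OF z] Q_map_finite_sum[OF z])
qed

theorem mainTheorem6: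
  fixes x :: "nat \<Rightarrow> 'x::operator_space"
    and f :: "nat \<Rightarrow> 'x \<Rightarrow> complex"
    and z :: "nat \<Rightarrow> 'z::operator_space"
    and K :: real
  assumes frame: "cb_frame x f"
    and normalized: "\<forall>i. norm (x i) = 1"
    and basis: "cb_basis z"
    and Q_conv: "\<forall>v. summable (\<lambda>i. basis_coeff z v i *\<^sub>C x i)"
    and Q_cb: "completely_bounded (Q_map z x)"
    and T_conv: "\<forall>v. summable (\<lambda>i. f i v *\<^sub>C z i)"
    and T_cb: "completely_bounded (T_map f z)"
    and K: "K = cb_norm (Q_map z x) * basis_const z"
  shows "(\<forall>n\<ge>1. \<forall>u \<in> fin_families n.
            triple_norm x n u \<le> K * mnorm (full_tensor_sum n u z)) \<and>
         (\<forall>e :: nat \<Rightarrow> 'y::operator_space. c00_completion x e \<longrightarrow>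
            (\<forall>n\<ge>1. \<forall>u \<in> fin_families n.
               mnorm (full_tensor_sum n u e) \<le> K * mnorm (full_tensor_sum n u z)))"
proof -
  have z: "schauder_basis z"
    and P_cb: "completely_bounded (basis_proj z m)"
    and P_bdd: "bdd_above (range (\<lambda>m. cb_norm (basis_proj z m)))" for m
    using basis by (auto simp: cb_basis_def)
  have main: "triple_norm x n u \<le> K * mnorm (full_tensor_sum n u z)"
    if n: "n \<ge> 1" and u: "u \<in> fin_families n" for n u
  proof (rule triple_norm_le[OF u])
    fix m
    let ?w = "full_tensor_sum n u z" and ?Q = "Q_map z x" and ?P = "basis_proj z m"
    have w: "?w \<in> carrier_mat n n"
      by (simp add: full_tensor_sum_def)
    have "mnorm (tensor_sum n {..m} u x) = mnorm (map_mat ?Q (map_mat ?P ?w))"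
      by (simp add: Q_map_basis_proj_tensor_sum[OF z u])
    also have "\<dots> \<le> cb_norm ?Q * mnorm (map_mat ?P ?w)"
      using w by (intro mnorm_map_le_cb_norm[OF Q_cb n]) simp
    also have "\<dots> \<le> cb_norm ?Q * (cb_norm ?P * mnorm ?w)"
      by (intro mult_left_mono mnorm_map_le_cb_norm[OF P_cb n w] cb_norm_nonneg[OF Q_cb])
    \<comment> \<open>Uniform boundedness of the projections makes \<open>basis_const z\<close> a
      genuine upper bound, independent of \<open>m\<close>.\<close>
    also have "\<dots> \<le> cb_norm ?Q * (basis_const z * mnorm ?w)"
      unfolding basis_const_def
      by (intro mult_left_mono mult_right_mono cSUP_upper P_bdd cb_norm_nonneg[OF Q_cb]
          mnorm_nonneg[OF n w]) simp
    finally show "mnorm (tensor_sum n {..m} u x) \<le> K * mnorm ?w"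
      by (simp add: K mult.assoc)
  qed
  \<comment> \<open>The embedding into \<open>Y\<close> is completely isometric, so the claim for
    \<open>e\<close> is the one for \<open>triple_norm\<close>.\<close>
  then show ?thesis
    by (simp add: c00_completion_def)
qed

end
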